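(* Let $\mathfrak{J}:\mathcal{S}\to\mathbb{R}_{\ge 0}$ be a set function satisfying the standing assumptions given in the context. If $\dim_\infty(\mathfrak{J})>0$, then $$\underline{F}\le\underline{h}\le\overline{h}=\mathfrak{q}=\kappa=\overline{F}.$$
   Context: Dyadic cubes. Let $d\in\mathbb{N}$. A dyadic cube of side length $2^{-n}$ is a product $I_1\times\cdots\times I_d$ of intervals of length $2^{-n}$ (each half-open, open, or closed) with endpoints in $\{k2^{-n}:k\in\mathbb{Z}\}$. Fix a dyadic unit cube $\mathcal{Q}\subset\mathbb{R}^d$ and partitions $\mathcal{D}_n$ of $\mathcal{Q}$ into dyadic cubes of side length $2^{-n}$ with $\mathcal{D}_0=\{\mathcal{Q}\}$ and such that each element of $\mathcal{D}_n$ is the disjoint union of exactly $2^d$ elements of $\mathcal{D}_{n+1}$. Put $\mathcal{D}=\bigcup_{n\ge0}\mathcal{D}_n$. Fix a subset $\mathcal{S}\subset\mathcal{D}$ and put $\mathcal{S}_n=\mathcal{S}\cap\mathcal{D}_n$. Standing assumptions on $\mathfrak{J}:\mathcal{S}\to\mathbb{R}_{\ge0}$: (1) non-trivial: $\mathfrak{J}\not\equiv0$; (2) monotone: $Q\subset Q'$ in $\mathcal{S}$ implies $\mathfrak{J}(Q)\le\mathfrak{J}(Q')$; (3) uniformly vanishing: $j_n:=\sup\{\mathfrak{J}(Q):Q\in\bigcup_{k\ge n}\mathcal{S}_k\}\to0$ as $n\to\infty$; (4) locally non-vanishing: for every $n\ge 0$ and $Q\in\mathcal{S}_n$ with $\mathfrak{J}(Q)>0$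 there is $Q'\in\mathcal{S}_{n+1}$ with $Q'\subset Q$ and $\mathfrak{J}(Q')>0$; (5) there exist $a>0$, $b\in\mathbb{R}$ with $\tau_n(a)\ge b$ for all large $n$ ($\tau_n$ defined below). Definitions. For $x>1/j_0$, $$G_x=\{Q\in\mathcal{S}:\mathfrak{J}(Q)<1/x\text{ and, if }Q\in\mathcal{D}_n,\ \exists Q'\in\mathcal{S}_{n-1}\text{ with }Q'\supset Q,\ \mathfrak{J}(Q')\ge1/x\},$$ $M(x)=\operatorname{card}(G_x)$, $\overline{h}=\limsup_{x\to\infty}\frac{\log M(x)}{\log x}$, $\underline{h}=\liminf_{x\to\infty}\frac{\log M(x)}{\log x}$. For $q\ge0$, $\tau_n(q)=\frac{1}{\log 2^n}\log\sum_{Q\in\mathcal{S}_n}\mathfrak{J}(Q)^q$ (with $0^0=0$) and $\tau(q)=\limsup_{n\to\infty}\tau_n(q)$. Further $\mathfrak{q}=\inf\{q\ge0:\tau(q)<0\}$, $\kappa=\inf\{q\ge0:\sum_{Q\in\mathcal{S}}\mathfrak{J}(Q)^q<\infty\}$, and $\dim_\infty(\mathfrak{J})=\liminf_{n\to\infty}\frac{\log\max_{Q\in\mathcal{S}_n}\mathfrak{J}(Q)}{-\log 2^n}$. For $\alpha>0$, $N_\alpha(n)=\operatorname{card}\{Q\in\mathcal{S}_n:\mathfrak{J}(Q)\ge2^{-\alpha n}\}$, $\overline{F}(\alpha)=\limsup_{n}\frac{\log^+N_\alpha(n)}{\log2^n}$, $\underline{F}(\alpha)=\liminf_{n}\frac{\log^+N_\alpha(n)}{\log2^n}$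 where $\log^+(y)=\max\{0,\log y\}$ (so $\log^+ 0=0$), and $\overline{F}=\sup_{\alpha>0}\overline{F}(\alpha)/\alpha$, $\underline{F}=\sup_{\alpha>0}\underline{F}(\alpha)/\alpha$. *)

theory Defs
  imports "HOL-Analysis.Analysis"
begin

text \<open>
  The ambient dimension $d$ is \<open>CARD('d)\<close>. The filtration of dyadic partitions is a function \<open>D\<close>
  from levels to sets of cubes, \<open>S\<close> is the distinguished family of cubes, so that the cubes of
  level \<open>n\<close> in it are \<open>S \<inter> D n\<close>. The set function \<open>J\<close> is total in HOL, but all notions below
  only use its values on \<open>S\<close>.
\<close>

definition dyadic_interval :: "nat \<Rightarrow> real set \<Rightarrow> bool" where
  "dyadic_interval n I \<longleftrightarrow>
     (\<exists>k::int. \<exists>l r. l = of_int k / 2 ^ n \<and> r = of_int (k + 1) / 2 ^ n \<and>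
        (I = {l..r} \<or> I = {l<..<r} \<or> I = {l<..r} \<or> I = {l..<r}))"

definition dyadic_cube :: "nat \<Rightarrow> (real ^ 'd) set \<Rightarrow> bool" where
  "dyadic_cube n Q \<longleftrightarrow>
     (\<exists>I. (\<forall>i. dyadic_interval n (I i)) \<and> Q = {x. \<forall>i. x $ i \<in> I i})"

definition dyadic_partitions :: "(real ^ 'd) set \<Rightarrow> (nat \<Rightarrow> (real ^ 'd) set set) \<Rightarrow> bool" where
  "dyadic_partitions Q0 D \<longleftrightarrow>
     dyadic_cube 0 Q0 \<and> D 0 = {Q0} \<and>
     (\<forall>n. partition_on Q0 (D n) \<and> (\<forall>Q\<in>D n. dyadic_cube n Q)) \<and>
     (\<forall>n. \<forall>Q\<in>D n. \<exists>C\<subseteq>D (Suc n). card C = 2 ^ CARD('d) \<and> disjoint C \<and> \<Union>C = Q)"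

subsection \<open>Conditions on the set function\<close>

definition nontrivial_on :: "(real ^ 'd) set set \<Rightarrow> ((real ^ 'd) set \<Rightarrow> real) \<Rightarrow> bool" where
  "nontrivial_on S J \<longleftrightarrow> (\<exists>Q\<in>S. J Q \<noteq> 0)"

definition monotone_set_function ::
    "(real ^ 'd) set set \<Rightarrow> ((real ^ 'd) set \<Rightarrow> real) \<Rightarrow> bool" where
  "monotone_set_function S J \<longleftrightarrow> (\<forall>Q\<in>S. \<forall>Q'\<in>S. Q \<subseteq> Q' \<longrightarrow> J Q \<le> J Q')"

definition tail_sup ::
    "(nat \<Rightarrow> (real ^ 'd) set set) \<Rightarrow> (real ^ 'd) set set \<Rightarrow> ((real ^ 'd) set \<Rightarrow> real) \<Rightarrow> nat \<Rightarrow> ereal"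
  where
  "tail_sup D S J n = (SUP Q\<in>(\<Union>k\<in>{n..}. S \<inter> D k). ereal (J Q))"

definition uniformly_vanishing ::
    "(nat \<Rightarrow> (real ^ 'd) set set) \<Rightarrow> (real ^ 'd) set set \<Rightarrow> ((real ^ 'd) set \<Rightarrow> real) \<Rightarrow> bool" where
  "uniformly_vanishing D S J \<longleftrightarrow> tail_sup D S J \<longlonglongrightarrow> 0"

definition locally_nonvanishing ::
    "(nat \<Rightarrow> (real ^ 'd) set set) \<Rightarrow> (real ^ 'd) set set \<Rightarrow> ((real ^ 'd) set \<Rightarrow> real) \<Rightarrow> bool" where
  "locally_nonvanishing D S J \<longleftrightarrow>
     (\<forall>n. \<forall>Q\<in>S \<inter> D n. J Q > 0 \<longrightarrow> (\<exists>Q'\<in>S \<inter> D (Suc n). Q' \<subseteq> Q \<and> J Q' > 0))"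

subsection \<open>Partition function and associated exponents\<close>

text \<open>
  HOL has \<open>0 powr q = 0\<close> for every \<open>q\<close>, which is the convention $0^0 = 0$ required here.
  If \<open>J\<close> is non-trivial and locally non-vanishing, then for all large \<open>n\<close> some cube in \<open>S \<inter> D n\<close>
  has positive \<open>J\<close>; hence the arguments of \<open>ln\<close> and \<open>Max\<close> below are degenerate for at most finitely
  many \<open>n\<close>, which does not affect the upper and lower limits. The same hypotheses (with uniform
  vanishing) make the counting number \<open>M x\<close> finite and positive for all large \<open>x\<close>.
  Limits, infima and suprema are taken in the extended reals, so that the infimum of the empty set
  is infinite.
\<close>

definition tau_n ::
    "(nat \<Rightarrow> (real ^ 'd) set set) \<Rightarrow> (real ^ 'd) set set \<Rightarrow> ((real ^ 'd) set \<Rightarrow> real) \<Rightarrow>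
     nat \<Rightarrow> real \<Rightarrow> real" where
  "tau_n D S J n q = ln (\<Sum>Q\<in>S \<inter> D n. J Q powr q) / ln (2 ^ n)"

definition tau ::
    "(nat \<Rightarrow> (real ^ 'd) set set) \<Rightarrow> (real ^ 'd) set set \<Rightarrow> ((real ^ 'd) set \<Rightarrow> real) \<Rightarrow>
     real \<Rightarrow> ereal" where
  "tau D S J q = limsup (\<lambda>n. ereal (tau_n D S J n q))"

definition tau_bounded_below ::
    "(nat \<Rightarrow> (real ^ 'd) set set) \<Rightarrow> (real ^ 'd) set set \<Rightarrow> ((real ^ 'd) set \<Rightarrow> real) \<Rightarrow> bool" where
  "tau_bounded_below D S J \<longleftrightarrow>
     (\<exists>a>0. \<exists>b. \<forall>\<^sub>F n in sequentially. tau_n D S J n a \<ge> b)"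

definition q_exponent ::
    "(nat \<Rightarrow> (real ^ 'd) set set) \<Rightarrow> (real ^ 'd) set set \<Rightarrow> ((real ^ 'd) set \<Rightarrow> real) \<Rightarrow> ereal" where
  "q_exponent D S J = (INF q\<in>{q. q \<ge> 0 \<and> tau D S J q < 0}. ereal q)"

definition kappa_exponent :: "(real ^ 'd) set set \<Rightarrow> ((real ^ 'd) set \<Rightarrow> real) \<Rightarrow> ereal" where
  "kappa_exponent S J = (INF q\<in>{q. q \<ge> 0 \<and> (\<lambda>Q. J Q powr q) summable_on S}. ereal q)"

definition dim_infty ::
    "(nat \<Rightarrow> (real ^ 'd) set set) \<Rightarrow> (real ^ 'd) set set \<Rightarrow> ((real ^ 'd) set \<Rightarrow> real) \<Rightarrow> ereal" where
  "dim_infty D S J = liminf (\<lambda>n. ereal (ln (Max (J ` (S \<inter> D n))) / (- ln (2 ^ n))))"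

subsection \<open>Largest cubes below a threshold\<close>

text \<open>
  A cube of level 0 has no predecessor and therefore never belongs to \<open>G x\<close>.
\<close>

definition G ::
    "(nat \<Rightarrow> (real ^ 'd) set set) \<Rightarrow> (real ^ 'd) set set \<Rightarrow> ((real ^ 'd) set \<Rightarrow> real) \<Rightarrow>
     real \<Rightarrow> (real ^ 'd) set set" where
  "G D S J x = {Q\<in>S. J Q < 1 / x \<and>
     (\<exists>n. Q \<in> D (Suc n) \<and> (\<exists>Q'\<in>S \<inter> D n. Q \<subseteq> Q' \<and> J Q' \<ge> 1 / x))}"

definition M ::
    "(nat \<Rightarrow> (real ^ 'd) set set) \<Rightarrow> (real ^ 'd) set set \<Rightarrow> ((real ^ 'd) set \<Rightarrow> real) \<Rightarrow> real \<Rightarrow> nat"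
  where
  "M D S J x = card (G D S J x)"

definition h_upper ::
    "(nat \<Rightarrow> (real ^ 'd) set set) \<Rightarrow> (real ^ 'd) set set \<Rightarrow> ((real ^ 'd) set \<Rightarrow> real) \<Rightarrow> ereal" where
  "h_upper D S J = Limsup at_top (\<lambda>x. ereal (ln (real (M D S J x)) / ln x))"

definition h_lower ::
    "(nat \<Rightarrow> (real ^ 'd) set set) \<Rightarrow> (real ^ 'd) set set \<Rightarrow> ((real ^ 'd) set \<Rightarrow> real) \<Rightarrow> ereal" where
  "h_lower D S J = Liminf at_top (\<lambda>x. ereal (ln (real (M D S J x)) / ln x))"

subsection \<open>Optimised coarse multifractal dimensions\<close>

definition N_alpha ::
    "(nat \<Rightarrow> (real ^ 'd) set set) \<Rightarrow> (real ^ 'd) set set \<Rightarrow> ((real ^ 'd) set \<Rightarrow> real) \<Rightarrow>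
     real \<Rightarrow> nat \<Rightarrow> nat" where
  "N_alpha D S J \<alpha> n = card {Q\<in>S \<inter> D n. J Q \<ge> 2 powr (- \<alpha> * real n)}"

definition log_plus :: "real \<Rightarrow> real" where
  "log_plus y = (if y > 0 then max 0 (ln y) else 0)"

definition F_upper_at ::
    "(nat \<Rightarrow> (real ^ 'd) set set) \<Rightarrow> (real ^ 'd) set set \<Rightarrow> ((real ^ 'd) set \<Rightarrow> real) \<Rightarrow>
     real \<Rightarrow> ereal" where
  "F_upper_at D S J \<alpha> = limsup (\<lambda>n. ereal (log_plus (real (N_alpha D S J \<alpha> n)) / ln (2 ^ n)))"

definition F_lower_at ::
    "(nat \<Rightarrow> (real ^ 'd) set set) \<Rightarrow> (real ^ 'd) set set \<Rightarrow> ((real ^ 'd) set \<Rightarrow> real) \<Rightarrow>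
     real \<Rightarrow> ereal" where
  "F_lower_at D S J \<alpha> = liminf (\<lambda>n. ereal (log_plus (real (N_alpha D S J \<alpha> n)) / ln (2 ^ n)))"

definition F_upper ::
    "(nat \<Rightarrow> (real ^ 'd) set set) \<Rightarrow> (real ^ 'd) set set \<Rightarrow> ((real ^ 'd) set \<Rightarrow> real) \<Rightarrow> ereal" where
  "F_upper D S J = (SUP \<alpha>\<in>{0<..}. F_upper_at D S J \<alpha> / ereal \<alpha>)"

definition F_lower ::
    "(nat \<Rightarrow> (real ^ 'd) set set) \<Rightarrow> (real ^ 'd) set set \<Rightarrow> ((real ^ 'd) set \<Rightarrow> real) \<Rightarrow> ereal" where
  "F_lower D S J = (SUP \<alpha>\<in>{0<..}. F_lower_at D S J \<alpha> / ereal \<alpha>)"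

end

theory Submission imports Defs "HOL-Real_Asymp.Real_Asymp" begin

text \<open>
  The equalities follow from the cycle of inequalities
  \<open>F_upper \<le> h_upper \<le> kappa_exponent \<le> q_exponent \<le> F_upper\<close>.

  A cube of level \<open>n\<close> in \<open>S\<close> with \<open>J Q \<ge> 1 / x\<close> has a path of descendants in \<open>S\<close> along which \<open>J\<close>
  stays positive but tends to 0. It crosses the threshold \<open>1 / x\<close> and thus meets \<open>G D S J x\<close>
  (lemma \<open>crossing\<close>). Cubes of one level are disjoint, so
  \<open>N_alpha D S J \<alpha> n \<le> M D S J x\<close> whenever \<open>2 powr (\<alpha> * n) \<le> x\<close> (lemma \<open>N_alpha_le_M\<close>). Taking
  logarithms yields the two comparisons of the coarse multifractal dimensions with \<open>h_upper\<close> and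
  \<open>h_lower\<close>.

  Conversely, the cubes of \<open>G D S J x\<close> are children of cubes with \<open>J Q \<ge> 1 / x\<close> (lemma \<open>G_bound\<close>),
  and Markov's inequality bounds the number of those by a multiple of \<open>x powr q\<close> if the sum of
  \<open>J Q powr q\<close> over \<open>S\<close> is finite. That sum is finite when \<open>tau D S J q < 0\<close>, because the sums
  over the levels then decay geometrically.

  The cycle is closed by showing \<open>tau D S J q < 0\<close> for every \<open>q > F_upper\<close>
  (lemma \<open>tau_neg_if_F_upper_less\<close>). The cubes of level \<open>n\<close> are sorted by the exponential size of
  \<open>J\<close> into finitely many classes; the size of each class is bounded through \<open>F_upper\<close>. The
  hypothesis \<open>dim_infty > 0\<close> keeps the exponents away from 0, so that the gain \<open>q - F_upper\<close>
  turns into exponential decay of the partition sum.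
\<close>

section \<open>The tree of dyadic cubes\<close>

text \<open>
  What matters about the cubes is the tree that they form under inclusion: every level is finite,
  and every cube of level \<open>n\<close> is split into \<open>2 ^ CARD('d)\<close> nonempty pairwise disjoint cubes of
  level \<open>Suc n\<close>.
\<close>
locale dyadic_filtration =
  fixes Q0 :: "(real ^ 'd) set" and D :: "nat \<Rightarrow> (real ^ 'd) set set"
  assumes dyadic: "dyadic_partitions Q0 D"
begin

lemma partition: "partition_on Q0 (D n)"
  using dyadic unfolding dyadic_partitions_def by blast

lemma nonempty: "Q \<in> D n \<Longrightarrow> Q \<noteq> {}"
  using partition_onD3[OF partition[of n]] by blast

lemma same_level_eq: "Q \<in> D n \<Longrightarrow> R \<in> D n \<Longrightarrow> Q \<inter> R \<noteq> {} \<Longrightarrow> Q = R"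
  using partition_onD2[OF partition[of n]] by (auto dest: disjointD)

lemma cover: "x \<in> Q0 \<Longrightarrow> \<exists>Q\<in>D n. x \<in> Q"
  using partition_onD1[OF partition[of n]] by blast

lemma subset_unit: "Q \<in> D n \<Longrightarrow> Q \<subseteq> Q0"
  using partition_onD1[OF partition[of n]] by blast

definition children :: "nat \<Rightarrow> (real ^ 'd) set \<Rightarrow> (real ^ 'd) set set" where
  "children n Q = {P \<in> D (Suc n). P \<subseteq> Q}"

lemma
  assumes "Q \<in> D n"
  shows card_children: "card (children n Q) = 2 ^ CARD('d)"
    and Union_children: "\<Union>(children n Q) = Q"
proof -
  \<comment> \<open>Disjointness at level \<open>Suc n\<close> makes the family supplied by the filtration
    equal to the family of all cubes of that level inside \<open>Q\<close>.\<close>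
  obtain C where C: "C \<subseteq> D (Suc n)" "card C = 2 ^ CARD('d)" "\<Union>C = Q"
    using dyadic assms unfolding dyadic_partitions_def by metis
  have "children n Q = C"
  proof
    show "C \<subseteq> children n Q" using C unfolding children_def by blast
    show "children n Q \<subseteq> C"
    proof
      fix P assume "P \<in> children n Q"
      then have P: "P \<in> D (Suc n)" "P \<subseteq> \<Union>C" using C by (auto simp: children_def)
      then obtain R where "R \<in> C" "P \<inter> R \<noteq> {}" using nonempty[OF P(1)] by blast
      then show "P \<in> C" using same_level_eq[OF P(1)] C(1) by blast
    qed
  qed
  then show "card (children n Q) = 2 ^ CARD('d)" "\<Union>(children n Q) = Q" using C by auto
qed

lemma finite_children: "Q \<in> D n \<Longrightarrow> finite (children n Q)"
  using card_children[of Q n] by (intro card_ge_0_finite) simp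

lemma parent_exists:
  assumes "P \<in> D (Suc n)"
  obtains Q where "Q \<in> D n" "P \<subseteq> Q"
proof -
  obtain x where x: "x \<in> P" using nonempty[OF assms] by blast
  then obtain Q where Q: "Q \<in> D n" "x \<in> Q" using cover subset_unit[OF assms] by blast
  then obtain R where R: "R \<in> children n Q" "x \<in> R" using Union_children[OF Q(1)] by blast
  then have "P = R" using same_level_eq[OF assms, of R] x unfolding children_def by blast
  then show ?thesis using that Q R unfolding children_def by blast
qed

lemma level_finite_card: "finite (D n) \<and> card (D n) \<le> 2 ^ (CARD('d) * n)"
proof (induction n)
  case 0
  have "D 0 = {Q0}" using dyadic unfolding dyadic_partitions_def by blast
  then show ?case by simp
next
  case (Suc n)
  have sub: "D (Suc n) \<subseteq> (\<Union>Q\<in>D n. children n Q)"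
  proof
    fix P assume P: "P \<in> D (Suc n)"
    then obtain Q where "Q \<in> D n" "P \<subseteq> Q" using parent_exists by blast
    then show "P \<in> (\<Union>Q\<in>D n. children n Q)" using P unfolding children_def by blast
  qed
  have fin: "finite (\<Union>Q\<in>D n. children n Q)" using Suc finite_children by blast
  have "card (D (Suc n)) \<le> (\<Sum>Q\<in>D n. card (children n Q))"
    using card_mono[OF fin sub] card_UN_le[of "D n" "children n"] Suc by simp
  also have "\<dots> = card (D n) * 2 ^ CARD('d)" by (simp add: card_children)
  also have "\<dots> \<le> 2 ^ (CARD('d) * n) * 2 ^ CARD('d)" using Suc by simp
  finally show ?case using finite_subset[OF sub fin] by (simp add: power_add mult.commute)
qed

lemma finite_level: "finite (D n)" using level_finite_card by blast

lemma nested: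
  assumes "Q \<in> D n" "R \<in> D (n + k)" "Q \<inter> R \<noteq> {}"
  shows "R \<subseteq> Q"
  using assms(2,3)
proof (induction k arbitrary: R)
  case 0
  then show ?case using same_level_eq[OF assms(1), of R] by simp
next
  case (Suc k)
  obtain P where "P \<in> D (n + k)" "R \<subseteq> P" using parent_exists[of R "n + k"] Suc by auto
  then show ?case using Suc by blast
qed

lemma child_psubset:
  assumes "Q \<in> D n" "P \<in> children n Q"
  shows "P \<subset> Q"
proof -
  have "\<not> children n Q \<subseteq> {P}"
  proof
    assume "children n Q \<subseteq> {P}"
    then have "card (children n Q) \<le> 1" using card_mono[of "{P}" "children n Q"] by simp
    moreover have "(2::nat) ^ CARD('d) > 1" by (rule one_less_power) auto
    ultimately show False using card_children[OF assms(1)] by simp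
  qed
  then obtain R where R: "R \<in> children n Q" "R \<noteq> P" by blast
  have "R \<inter> P = {}" using same_level_eq[of R "Suc n" P] R assms unfolding children_def by blast
  moreover have "R \<noteq> {}" "R \<subseteq> Q" "P \<subseteq> Q"
    using nonempty[of R "Suc n"] R assms unfolding children_def by auto
  ultimately show ?thesis by blast
qed

text \<open>
  A cube has at least two disjoint nonempty children, so passing to a later level strictly shrinks
  it. Hence a cube determines its level, and \<open>S\<close> is the disjoint union of the families
  \<open>S \<inter> D n\<close>. This is needed since \<open>G\<close> and the sums over all of \<open>S\<close> do not record the level.
\<close>
lemma level_unique:
  assumes "Q \<in> D m" "Q \<in> D n"
  shows "m = n"
proof -
  have no: False if Qi: "Q \<in> D i" and Qk: "Q \<in> D (Suc i + k)" for i k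
  proof -
    obtain x where "x \<in> Q" using nonempty[OF Qi] by blast
    then obtain P where P: "P \<in> children i Q" "x \<in> P" using Union_children[OF Qi] by blast
    then have "Q \<subseteq> P" using nested[of P "Suc i" Q k] Qk \<open>x \<in> Q\<close> unfolding children_def by blast
    then show False using child_psubset[OF Qi P(1)] by blast
  qed
  show ?thesis
  proof (rule ccontr)
    assume "m \<noteq> n"
    then consider "m < n" | "n < m" by linarith
    then show False
    proof cases
      case 1 then show False using no[of m "n - Suc m"] assms by simp
    next
      case 2 then show False using no[of n "m - Suc n"] assms by simp
    qed
  qed
qed

end

section \<open>Descending to the threshold\<close>

locale vanishing_set_function = dyadic_filtration Q0 D
  for Q0 :: "(real ^ 'd) set" and D :: "nat \<Rightarrow> (real ^ 'd) set set" +
  fixes S :: "(real ^ 'd) set set" and J :: "(real ^ 'd) set \<Rightarrow> real"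
  assumes S_subset: "S \<subseteq> (\<Union>n. D n)"
    and J_nonneg: "Q \<in> S \<Longrightarrow> J Q \<ge> 0"
    and nontrivial: "nontrivial_on S J"
    and vanishing: "uniformly_vanishing D S J"
    and nonvanishing: "locally_nonvanishing D S J"
begin

lemma descend:
  assumes "Q \<in> S \<inter> D n" "J Q > 0"
  obtains Q' where "Q' \<in> S \<inter> D (Suc n)" "Q' \<subseteq> Q" "J Q' > 0"
  using nonvanishing assms unfolding locally_nonvanishing_def by blast

lemma eventually_small:
  assumes "x > 0"
  shows "\<exists>N. \<forall>n\<ge>N. \<forall>Q\<in>S \<inter> D n. J Q < 1 / x"
proof -
  have "\<forall>\<^sub>F n in sequentially. tail_sup D S J n < ereal (1 / x)"
    using vanishing assms unfolding uniformly_vanishing_def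
    by (intro order_tendstoD) (auto simp: zero_ereal_def)
  then obtain N where N: "tail_sup D S J N < ereal (1 / x)"
    unfolding eventually_sequentially by blast
  have "J Q < 1 / x" if "n \<ge> N" "Q \<in> S \<inter> D n" for n Q
  proof -
    have "ereal (J Q) \<le> tail_sup D S J N"
      unfolding tail_sup_def by (rule SUP_upper) (use that in auto)
    then show ?thesis using N by (metis ereal_less_le less_ereal.simps(1) order_le_less_trans)
  qed
  then show ?thesis by blast
qed

text \<open>
  This keeps the arguments of \<open>ln\<close> in \<open>tau_n\<close> and \<open>dim_infty\<close> positive on all large levels.
\<close>
lemma eventually_positive: "\<forall>\<^sub>F n in sequentially. \<exists>Q\<in>S \<inter> D n. J Q > 0"
proof -
  obtain Q where Q: "Q \<in> S" "J Q > 0"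
    using nontrivial J_nonneg unfolding nontrivial_on_def by (metis less_eq_real_def)
  then obtain N where N: "Q \<in> D N" using S_subset by blast
  have "\<exists>Q\<in>S \<inter> D (N + k). J Q > 0" for k
  proof (induction k)
    case 0 then show ?case using Q N by auto
  next
    case (Suc k) then show ?case by (metis add_Suc_right descend)
  qed
  then show ?thesis unfolding eventually_sequentially by (metis le_Suc_ex)
qed

text \<open>
  Starting in \<open>Q\<close> and repeatedly passing to a child in \<open>S\<close> with positive value, the values
  eventually fall below \<open>1 / x\<close> because \<open>J\<close> vanishes uniformly. The first cube where this happens
  belongs to \<open>G D S J x\<close>: its predecessor lies on the path and therefore in \<open>S\<close>, even though \<open>S\<close>
  as a whole need not be closed under predecessors.
\<close>
lemma crossing:
  assumes "x > 0" "Q \<in> S \<inter> D n" "J Q \<ge> 1 / x"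
  obtains P where "P \<in> G D S J x" "P \<subseteq> Q"
proof -
  obtain N where N: "\<forall>n\<ge>N. \<forall>Q\<in>S \<inter> D n. J Q < 1 / x" using eventually_small[OF assms(1)] by blast
  \<comment> \<open>All cubes of level at least \<open>N\<close> are below the threshold, so the descent ends within \<open>N - n\<close> steps.\<close>
  have "\<exists>P\<in>G D S J x. P \<subseteq> Q"
    using assms(2,3)
  proof (induction "N - n" arbitrary: n Q rule: less_induct)
    case less
    then have "n < N" using N by (meson leI not_le)
    have "J Q > 0" using less.prems assms(1) by (smt (verit) divide_pos_pos)
    then obtain P where P: "P \<in> S \<inter> D (Suc n)" "P \<subseteq> Q" using descend less.prems by blast
    show ?case
    proof (cases "J P < 1 / x")
      case True
      then have "P \<in> G D S J x" unfolding G_def using P less.prems by blast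
      then show ?thesis using P by blast
    next
      case False
      then have "\<exists>R\<in>G D S J x. R \<subseteq> P" using less.hyps[of "Suc n" P] P \<open>n < N\<close> by simp
      then show ?thesis using P by blast
    qed
  qed
  then show ?thesis using that by blast
qed

lemma finite_superlevel:
  assumes "x > 0"
  shows "finite {Q \<in> S. J Q \<ge> 1 / x}"
proof -
  obtain N where N: "\<forall>n\<ge>N. \<forall>Q\<in>S \<inter> D n. J Q < 1 / x" using eventually_small[OF assms(1)] by blast
  have "{Q \<in> S. J Q \<ge> 1 / x} \<subseteq> (\<Union>n\<in>{..<N}. D n)"
  proof
    fix Q assume Q: "Q \<in> {Q \<in> S. J Q \<ge> 1 / x}"
    then obtain n where n: "Q \<in> D n" using S_subset by blast
    then have "n < N" using N Q by (metis (lifting) IntI leI mem_Collect_eq not_le)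
    then show "Q \<in> (\<Union>n\<in>{..<N}. D n)" using n by blast
  qed
  then show ?thesis by (rule finite_subset) (simp add: finite_level)
qed

text \<open>
  A cube of \<open>G D S J x\<close> is a child of a cube whose value is at least \<open>1 / x\<close>, and each such cube
  has only \<open>2 ^ CARD('d)\<close> children. Finiteness matters because \<open>card\<close> of an infinite set is 0, which
  would make \<open>M\<close> meaningless as a count.
\<close>
lemma G_bound:
  assumes "x > 0"
  shows "finite (G D S J x)" "M D S J x \<le> 2 ^ CARD('d) * card {Q \<in> S. J Q \<ge> 1 / x}"
proof -
  define A where "A = {Q \<in> S. J Q \<ge> 1 / x}"
  define lev where "lev Q = (THE n. Q \<in> D n)" for Q
  have lev: "lev Q = n" if "Q \<in> D n" for Q n
    unfolding lev_def using that level_unique by blast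
  have fA: "finite A" unfolding A_def using finite_superlevel assms by blast
  have levA: "Q \<in> D (lev Q)" if "Q \<in> A" for Q
    using that S_subset lev unfolding A_def by blast
  have sub: "G D S J x \<subseteq> (\<Union>Q\<in>A. children (lev Q) Q)"
    unfolding G_def A_def children_def using lev by auto
  have fin: "finite (\<Union>Q\<in>A. children (lev Q) Q)" using fA finite_children levA by blast
  then show "finite (G D S J x)" using sub finite_subset by blast
  have "M D S J x \<le> (\<Sum>Q\<in>A. card (children (lev Q) Q))"
    unfolding M_def using card_mono[OF fin sub] card_UN_le[OF fA, of "\<lambda>Q. children (lev Q) Q"] by linarith
  also have "\<dots> = 2 ^ CARD('d) * card A" by (simp add: card_children levA)
  finally show "M D S J x \<le> 2 ^ CARD('d) * card {Q \<in> S. J Q \<ge> 1 / x}" unfolding A_def .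
qed

text \<open>
  The cubes counted by \<open>N_alpha\<close> all have the same level and so are pairwise disjoint; hence the
  cubes of \<open>G D S J x\<close> reached by descending from each of them are distinct.
\<close>
lemma N_alpha_le_M:
  assumes "2 powr (\<alpha> * real n) \<le> x"
  shows "N_alpha D S J \<alpha> n \<le> M D S J x"
proof -
  have x: "x > 0" using assms by (smt (verit) powr_gt_zero)
  define A where "A = {Q\<in>S \<inter> D n. J Q \<ge> 2 powr (- \<alpha> * real n)}"
  have "1 / x \<le> 2 powr (- \<alpha> * real n)"
    using assms x by (simp add: powr_minus field_simps)
  then have AD: "Q \<in> S \<inter> D n \<and> J Q \<ge> 1 / x" if "Q \<in> A" for Q
    using that unfolding A_def by auto
  have "\<exists>P\<in>G D S J x. P \<subseteq> Q" if "Q \<in> A" for Q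
    using AD[OF that] crossing[OF x, of Q n] by blast
  then obtain p where p: "\<And>Q. Q \<in> A \<Longrightarrow> p Q \<in> G D S J x \<and> p Q \<subseteq> Q" by metis
  have ne: "P \<noteq> {}" if "P \<in> G D S J x" for P
    using that nonempty unfolding G_def by blast
  have "inj_on p A"
  proof (rule inj_onI)
    fix Q R assume QR: "Q \<in> A" "R \<in> A" "p Q = p R"
    then have "Q \<inter> R \<noteq> {}" using p[of Q] p[of R] ne by blast
    then show "Q = R" using same_level_eq QR unfolding A_def by blast
  qed
  then have "card A \<le> card (G D S J x)"
    using p G_bound(1)[OF x] by (intro card_inj_on_le[of p]) auto
  then show ?thesis unfolding A_def N_alpha_def M_def .
qed

text \<open>
  Here \<open>ln 0 = 0\<close> helps: the right-hand side is nonnegative even if \<open>M D S J x = 0\<close>.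
\<close>
lemma log_plus_N_alpha_le:
  assumes "2 powr (\<alpha> * real n) \<le> x"
  shows "log_plus (real (N_alpha D S J \<alpha> n)) \<le> ln (real (M D S J x))"
proof (cases "N_alpha D S J \<alpha> n = 0")
  case True
  then show ?thesis unfolding log_plus_def by (cases "M D S J x = 0") auto
next
  case False
  then show ?thesis using N_alpha_le_M[OF assms] unfolding log_plus_def by simp
qed

section \<open>Coarse multifractal dimensions bound the growth of M from below\<close>

lemma h_lower_nonneg: "h_lower D S J \<ge> 0"
  unfolding h_lower_def
proof (rule Liminf_bounded)
  show "\<forall>\<^sub>F x in at_top. 0 \<le> ereal (ln (real (M D S J x)) / ln x)"
    using eventually_gt_at_top[of 1]
  proof eventually_elim
    case (elim x)
    then show ?case by (cases "M D S J x = 0") auto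
  qed
qed

text \<open>
  Comparing \<open>N_alpha\<close> at level \<open>n\<close> with \<open>M\<close> along the sequence \<open>x = 2 powr (\<alpha> * n)\<close>
  suffices, since an upper limit along a sequence is at most the full upper limit.
\<close>
lemma F_upper_le_h_upper: "F_upper D S J \<le> h_upper D S J"
  unfolding F_upper_def
proof (rule SUP_least, rule dense_ge)
  fix \<alpha> :: real and y :: ereal
  assume "\<alpha> \<in> {0<..}" and y: "h_upper D S J < y"
  then have \<alpha>: "\<alpha> > 0" by simp
  have "\<forall>\<^sub>F x in at_top. ereal (ln (real (M D S J x)) / ln x) < y"
    using y unfolding h_upper_def by (rule Limsup_lessD)
  moreover have "filterlim (\<lambda>n. 2 powr (\<alpha> * real n)) at_top sequentially"
    using \<alpha> by real_asymp
  ultimately have "\<forall>\<^sub>F n in sequentially.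
      ereal (ln (real (M D S J (2 powr (\<alpha> * real n)))) / ln (2 powr (\<alpha> * real n))) < y"
    unfolding filterlim_iff by blast
  then have "F_upper_at D S J \<alpha> \<le> ereal \<alpha> * y"
    unfolding F_upper_at_def
  proof (intro Limsup_bounded, eventually_elim)
    case (elim n)
    let ?L = "ln (real (M D S J (2 powr (\<alpha> * real n))))"
    have "log_plus (real (N_alpha D S J \<alpha> n)) / ln (2 ^ n) \<le> ?L / ln (2 ^ n)"
      by (intro divide_right_mono log_plus_N_alpha_le) auto
    also have "\<dots> = \<alpha> * (?L / ln (2 powr (\<alpha> * real n)))"
      using \<alpha> by (simp add: ln_realpow ln_powr)
    finally have "ereal (log_plus (real (N_alpha D S J \<alpha> n)) / ln (2 ^ n))
        \<le> ereal \<alpha> * ereal (?L / ln (2 powr (\<alpha> * real n)))" by simp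
    also have "\<dots> \<le> ereal \<alpha> * y"
      using elim \<alpha> by (intro ereal_mult_left_mono) auto
    finally show ?case .
  qed
  then show "F_upper_at D S J \<alpha> / ereal \<alpha> \<le> y"
    using \<alpha> by (simp add: ereal_divide_le_pos)
qed

text \<open>
  A lower limit must be controlled for all large real \<open>x\<close>. The largest level \<open>k x\<close> with
  \<open>2 powr (\<alpha> * k x) \<le> x\<close> satisfies \<open>k x > log 2 x / \<alpha> - 1\<close>, and the rounding error of one level
  is negligible relative to \<open>ln x\<close>.
\<close>
lemma F_lower_le_h_lower: "F_lower D S J \<le> h_lower D S J"
  unfolding F_lower_def
proof (rule SUP_least)
  fix \<alpha> :: real
  assume "\<alpha> \<in> {0<..}"
  then have \<alpha>: "\<alpha> > 0" by simp
  have step: "ereal (c / \<alpha>) \<le> h_lower D S J"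
    if c: "c > 0" "ereal c < F_lower_at D S J \<alpha>" for c
  proof -
    define k where "k x = nat \<lfloor>log 2 x / \<alpha>\<rfloor>" for x :: real
    have "filterlim (\<lambda>x. log 2 x / \<alpha>) at_top at_top"
      using \<alpha> by real_asymp
    then have "filterlim k sequentially at_top"
      unfolding k_def
      by (intro filterlim_compose[OF filterlim_nat_sequentially]
          filterlim_compose[OF filterlim_floor_sequentially])
    moreover have "\<forall>\<^sub>F n in sequentially.
        ereal c < ereal (log_plus (real (N_alpha D S J \<alpha> n)) / ln (2 ^ n))"
      using c(2) unfolding F_lower_at_def by (rule less_LiminfD)
    ultimately have "\<forall>\<^sub>F x in at_top.
        ereal c < ereal (log_plus (real (N_alpha D S J \<alpha> (k x))) / ln (2 ^ k x))"
      unfolding filterlim_iff by blast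
    then have ev: "\<forall>\<^sub>F x in at_top.
        ereal (c * (1 / \<alpha> - ln 2 / ln x)) \<le> ereal (ln (real (M D S J x)) / ln x)"
      using eventually_gt_at_top[of 1]
    proof eventually_elim
      case (elim x)
      have "log 2 x / \<alpha> \<ge> 0" using elim \<alpha> by simp
      then have k: "real (k x) \<le> log 2 x / \<alpha>" "real (k x) \<ge> log 2 x / \<alpha> - 1"
        unfolding k_def by linarith+
      have "\<alpha> * real (k x) \<le> log 2 x" using k(1) \<alpha> by (simp add: field_simps)
      then have "2 powr (\<alpha> * real (k x)) \<le> x"
        using elim by (simp add: le_log_iff)
      then have le: "log_plus (real (N_alpha D S J \<alpha> (k x))) \<le> ln (real (M D S J x))"
        by (rule log_plus_N_alpha_le)
      \<comment> \<open>At level 0 the quotient is \<open>_ / ln 1 = 0\<close>, which does not exceed \<open>c > 0\<close>.\<close>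
      have "k x \<noteq> 0" using elim c(1) by (cases "k x") auto
      then have "c * (real (k x) * ln 2) < log_plus (real (N_alpha D S J \<alpha> (k x)))"
        using elim(1) by (simp add: ln_realpow field_simps)
      moreover have "c * ((log 2 x / \<alpha> - 1) * ln 2) \<le> c * (real (k x) * ln 2)"
        using k(2) c(1) by (intro mult_left_mono mult_right_mono) auto
      moreover have "c * ((log 2 x / \<alpha> - 1) * ln 2) = c * (1 / \<alpha> - ln 2 / ln x) * ln x"
        using elim(2) \<alpha> by (simp add: log_def field_simps)
      ultimately have "c * (1 / \<alpha> - ln 2 / ln x) * ln x \<le> ln (real (M D S J x))"
        using le by linarith
      then show ?case using elim(2) by (simp add: pos_le_divide_eq)
    qed
    have "((\<lambda>x. c * (1 / \<alpha> - ln 2 / ln x)) \<longlongrightarrow> c / \<alpha>) at_top"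
      by real_asymp
    then have "Liminf at_top (\<lambda>x. ereal (c * (1 / \<alpha> - ln 2 / ln x))) = ereal (c / \<alpha>)"
      by (intro lim_imp_Liminf tendsto_ereal) auto
    then show ?thesis using Liminf_mono[OF ev] unfolding h_lower_def by simp
  qed
  have "F_lower_at D S J \<alpha> \<le> ereal \<alpha> * h_lower D S J"
  proof (rule dense_le)
    fix y assume y: "y < F_lower_at D S J \<alpha>"
    have nn: "0 \<le> ereal \<alpha> * h_lower D S J" using \<alpha> h_lower_nonneg by simp
    show "y \<le> ereal \<alpha> * h_lower D S J"
    proof (cases "y \<le> 0")
      case True
      then show ?thesis using nn by (rule order_trans)
    next
      case False
      then obtain c where c: "y = ereal c" "c > 0" using y by (cases y) auto
      have "ereal c / ereal \<alpha> \<le> h_lower D S J" using step c y \<alpha> by simp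
      then show ?thesis using \<alpha> c by (simp add: ereal_divide_le_pos del: ereal_divide)
    qed
  qed
  then show "F_lower_at D S J \<alpha> / ereal \<alpha> \<le> h_lower D S J"
    using \<alpha> by (simp add: ereal_divide_le_pos)
qed

section \<open>Summability exponents bound the growth of M from above\<close>

text \<open>
  This is Markov's inequality: the number of cubes with \<open>J Q \<ge> 1 / x\<close> is at most
  \<open>x powr q\<close> times the sum of \<open>J Q powr q\<close>, and \<open>M\<close> exceeds this number by at most a constant factor.
\<close>
lemma h_upper_le_kappa: "h_upper D S J \<le> kappa_exponent S J"
  unfolding kappa_exponent_def
proof (rule INF_greatest)
  fix q assume "q \<in> {q. 0 \<le> q \<and> (\<lambda>Q. J Q powr q) summable_on S}"
  then have q: "q \<ge> 0" "(\<lambda>Q. J Q powr q) summable_on S" by auto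
  define K where "K = infsum (\<lambda>Q. J Q powr q) S"
  have K: "K \<ge> 0" unfolding K_def by (rule infsum_nonneg) simp
  \<comment> \<open>The summand 1 makes \<open>B * x powr q\<close> at least 1, so that the bound also holds for \<open>ln 0 = 0\<close>.\<close>
  define B where "B = 1 + 2 ^ CARD('d) * K"
  have B: "B \<ge> 1" unfolding B_def using K by simp
  have ev: "\<forall>\<^sub>F x in at_top. ereal (ln (real (M D S J x)) / ln x) \<le> ereal (ln B / ln x + q)"
    using eventually_gt_at_top[of 1]
  proof eventually_elim
    case (elim x)
    then have x: "x > 0" by simp
    define A where "A = {Q \<in> S. J Q \<ge> 1 / x}"
    have "real (card A) = (\<Sum>Q\<in>A. 1)" by simp
    also have "\<dots> \<le> (\<Sum>Q\<in>A. x powr q * J Q powr q)"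
    proof (rule sum_mono)
      fix Q assume "Q \<in> A"
      then have "1 \<le> x * J Q" "J Q \<ge> 0"
        unfolding A_def using x J_nonneg by (auto simp: field_simps)
      then show "1 \<le> x powr q * J Q powr q"
        using q(1) x ge_one_powr_ge_zero[of "x * J Q" q] by (simp add: powr_mult)
    qed
    also have "\<dots> = x powr q * (\<Sum>Q\<in>A. J Q powr q)" by (simp add: sum_distrib_left)
    also have "\<dots> \<le> x powr q * K"
      unfolding K_def A_def using q(2) finite_superlevel[OF x]
      by (intro mult_left_mono finite_sum_le_infsum) auto
    finally have cA: "real (card A) \<le> x powr q * K" .
    have "real (M D S J x) \<le> real (2 ^ CARD('d) * card A)"
      using G_bound(2)[OF x] unfolding A_def of_nat_le_iff .
    also have "\<dots> \<le> 2 ^ CARD('d) * (x powr q * K)" using cA by simp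
    also have "\<dots> \<le> B * x powr q" unfolding B_def by (simp add: algebra_simps)
    finally have MB: "real (M D S J x) \<le> B * x powr q" .
    have ge1: "1 \<le> B * x powr q"
      using B ge_one_powr_ge_zero[of x q] q elim mult_mono[of 1 B 1 "x powr q"] by simp
    have "ln (real (M D S J x)) \<le> ln (B * x powr q)"
      using MB ge1 by (cases "M D S J x = 0") auto
    also have "\<dots> = ln B + q * ln x" using B x by (simp add: ln_mult ln_powr)
    finally show ?case using elim by (simp add: field_simps)
  qed
  have "((\<lambda>x. ln B / ln x + q) \<longlongrightarrow> q) at_top" by real_asymp
  then have "Limsup at_top (\<lambda>x. ereal (ln B / ln x + q)) = ereal q"
    by (intro lim_imp_Limsup tendsto_ereal) auto
  then show "h_upper D S J \<le> ereal q" using Limsup_mono[OF ev] unfolding h_upper_def by simp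
qed

text \<open>
  If \<open>tau D S J q\<close> is below some \<open>z < 0\<close>, the partition sums over the levels are eventually
  dominated by the geometric series with ratio \<open>2 powr z\<close>.
\<close>
lemma summable_if_tau_neg:
  assumes "tau D S J q < 0"
  shows "(\<lambda>Q. J Q powr q) summable_on S"
proof -
  define s where "s n = (\<Sum>Q\<in>S \<inter> D n. J Q powr q)" for n
  have s0: "s n \<ge> 0" for n unfolding s_def by (rule sum_nonneg) simp
  obtain z where z: "tau D S J q < ereal z" "ereal z < 0" using ereal_dense2[OF assms] by blast
  have "\<forall>\<^sub>F n in sequentially. ereal (tau_n D S J n q) < ereal z"
    using z(1) unfolding tau_def by (rule Limsup_lessD)
  then have "\<forall>\<^sub>F n in sequentially. norm (s n) \<le> (2 powr z) ^ n"
    using eventually_gt_at_top[of 0]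
  proof eventually_elim
    case (elim n)
    have "s n \<le> 2 powr (z * real n)"
    proof (cases "s n = 0")
      case False
      then have "s n > 0" using s0[of n] by simp
      have "ln (s n) < z * real n * ln 2"
        using elim unfolding tau_n_def s_def[symmetric] by (simp add: ln_realpow field_simps)
      then have "ln (s n) \<le> ln (2 powr (z * real n))" by (simp add: ln_powr)
      then show ?thesis using \<open>s n > 0\<close> by (simp only: ln_le_cancel_iff powr_gt_zero)
    qed simp
    then show ?case using s0[of n] by (simp add: powr_powr[symmetric] powr_realpow)
  qed
  moreover have "summable (\<lambda>n. (2 powr z) ^ n)"
    using z(2) by (intro summable_geometric) (simp add: zero_ereal_def powr_less_one)
  ultimately have sum: "summable s" by (rule summable_comparison_test_ev)
  show ?thesis
  proof (rule nonneg_bdd_above_summable_on, simp, rule bdd_aboveI2)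
    fix F assume "F \<in> {F. F \<subseteq> S \<and> finite F}"
    then have F: "F \<subseteq> S" "finite F" by auto
    then obtain l where l: "\<And>Q. Q \<in> F \<Longrightarrow> Q \<in> D (l Q)" using S_subset by (metis UN_E subsetD)
    obtain N where N: "\<And>Q. Q \<in> F \<Longrightarrow> l Q < N"
      using F(2) by (metis finite_imageI finite_nat_set_iff_bounded imageI)
    have "(\<Sum>Q\<in>F. J Q powr q) \<le> (\<Sum>Q\<in>(\<Union>n\<in>{..<N}. S \<inter> D n). J Q powr q)"
      using F l N by (intro sum_mono2) (auto simp: finite_level)
    also have "\<dots> = (\<Sum>n<N. s n)"
      unfolding s_def using level_unique
      by (intro sum.UNION_disjoint) (auto simp: finite_level)
    also have "\<dots> \<le> suminf s" using sum s0 by (intro sum_le_suminf) auto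
    finally show "(\<Sum>Q\<in>F. J Q powr q) \<le> suminf s" .
  qed
qed

lemma kappa_le_q_exponent: "kappa_exponent S J \<le> q_exponent D S J"
  unfolding kappa_exponent_def q_exponent_def
  using summable_if_tau_neg by (intro INF_superset_mono) auto

section \<open>Decay of the partition function beyond the coarse multifractal dimension\<close>

lemma F_upper_nonneg: "F_upper D S J \<ge> 0"
proof -
  have "0 \<le> F_upper_at D S J 1"
    unfolding F_upper_at_def
    by (rule order_trans[OF Liminf_bounded Liminf_le_Limsup])
      (auto simp: log_plus_def)
  also have "\<dots> = F_upper_at D S J 1 / ereal 1" by (simp add: one_ereal_def[symmetric])
  also have "\<dots> \<le> F_upper D S J" unfolding F_upper_def by (rule SUP_upper) simp
  finally show ?thesis .
qed

lemma eventually_N_alpha_le: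
  assumes "F_upper D S J < ereal r" "\<alpha> > 0"
  shows "\<forall>\<^sub>F n in sequentially. real (N_alpha D S J \<alpha> n) \<le> 2 powr (\<alpha> * r * real n)"
proof -
  have "F_upper_at D S J \<alpha> / ereal \<alpha> \<le> F_upper D S J"
    unfolding F_upper_def using assms by (intro SUP_upper) simp
  also note assms(1)
  finally have "F_upper_at D S J \<alpha> < ereal (\<alpha> * r)"
    using assms(2) by (simp add: ereal_divide_less_pos)
  then have "\<forall>\<^sub>F n in sequentially.
      ereal (log_plus (real (N_alpha D S J \<alpha> n)) / ln (2 ^ n)) < ereal (\<alpha> * r)"
    unfolding F_upper_at_def by (rule Limsup_lessD)
  then show ?thesis
    using eventually_gt_at_top[of 0]
  proof eventually_elim
    case (elim n)
    show ?case
    proof (cases "N_alpha D S J \<alpha> n = 0")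
      case False
      then have "ln (real (N_alpha D S J \<alpha> n)) \<le> log_plus (real (N_alpha D S J \<alpha> n))"
        unfolding log_plus_def by simp
      also have "\<dots> < \<alpha> * r * real n * ln 2"
        using elim by (simp add: ln_realpow field_simps)
      finally have "ln (real (N_alpha D S J \<alpha> n)) \<le> ln (2 powr (\<alpha> * r * real n))"
        by (simp add: ln_powr)
      then show ?thesis using False by (subst (asm) ln_le_cancel_iff) auto
    qed simp
  qed
qed

lemma eventually_J_le:
  assumes "dim_infty D S J > 0"
  obtains c where "c > 0" "\<forall>\<^sub>F n in sequentially. \<forall>Q\<in>S \<inter> D n. J Q \<le> 2 powr (- c * real n)"
proof -
  obtain c where c: "0 < ereal c" "ereal c < dim_infty D S J" using ereal_dense2[OF assms] by blast
  have "\<forall>\<^sub>F n in sequentially. ereal c < ereal (ln (Max (J ` (S \<inter> D n))) / (- ln (2 ^ n)))"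
    using c(2) unfolding dim_infty_def by (rule less_LiminfD)
  then have "\<forall>\<^sub>F n in sequentially. \<forall>Q\<in>S \<inter> D n. J Q \<le> 2 powr (- c * real n)"
    using eventually_positive eventually_gt_at_top[of 0]
  proof eventually_elim
    case (elim n)
    define m where "m = Max (J ` (S \<inter> D n))"
    have le: "J Q \<le> m" if "Q \<in> S \<inter> D n" for Q
      unfolding m_def using that finite_level by (intro Max_ge) auto
    then have m: "m > 0" using elim(2) by (meson less_le_trans)
    have "ln m < - c * real n * ln 2"
      using elim(1,3) unfolding m_def[symmetric] by (simp add: ln_realpow field_simps)
    then have "ln m \<le> ln (2 powr (- c * real n))" by (simp add: ln_powr)
    then have "m \<le> 2 powr (- c * real n)" using m by (subst (asm) ln_le_cancel_iff) auto
    then show ?case using le by (meson order_trans)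
  qed
  then show ?thesis using that c(1) by simp
qed

text \<open>
  Let \<open>F_upper D S J < r < q\<close>, and let \<open>J Q \<le> 2 powr (- c * n)\<close> on every large level \<open>n\<close>.
  Sort the cubes of level \<open>n\<close> by the size of \<open>J\<close>, with the thresholds \<open>2 powr (- a i * n)\<close> on
  the grid \<open>a i = c + i * \<delta>\<close> for \<open>i \<le> k\<close>. The cubes between two consecutive thresholds number at
  most \<open>2 powr (a i * r * n)\<close> and each contributes at most \<open>2 powr (- (a i - \<delta>) * q * n)\<close>, so
  together they contribute at most \<open>2 powr (- ((q - r) * a i - \<delta> * q) * n)\<close>. Since \<open>a i \<ge> c\<close>,
  this decays exponentially once \<open>\<delta>\<close> is small; here the positivity of \<open>dim_infty\<close> is essential.
  The cubes below the last threshold are so small that the crude bound \<open>2 ^ (CARD('d) * n)\<close> on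
  their number suffices.
\<close>
lemma tau_neg_if_F_upper_less:
  assumes "dim_infty D S J > 0" "F_upper D S J < ereal q"
  shows "tau D S J q < 0"
proof -
  obtain r where r: "F_upper D S J < ereal r" "ereal r < ereal q" using ereal_dense2[OF assms(2)] by blast
  have r0: "r > 0" using F_upper_nonneg r(1) by (metis ereal_less(2) le_less_trans)
  have rq: "r < q" and q0: "q > 0" using r r0 by auto
  obtain c where c: "c > 0" and
    evJ: "\<forall>\<^sub>F n in sequentially. \<forall>Q\<in>S \<inter> D n. J Q \<le> 2 powr (- c * real n)"
    using eventually_J_le[OF assms(1)] by blast
  \<comment> \<open>The mesh \<open>\<delta>\<close> is chosen so that \<open>\<delta> * q\<close> is half of the available gain \<open>(q - r) * c\<close>.\<close>
  define \<eta> where "\<eta> = (q - r) * c / 2"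
  define \<delta> where "\<delta> = \<eta> / q"
  define a where "a i = c + real i * \<delta>" for i :: nat
  have \<eta>: "\<eta> > 0" and \<delta>: "\<delta> > 0" unfolding \<eta>_def \<delta>_def using rq c q0 by auto
  have a_pos: "a i > 0" and a_ge: "a i \<ge> c" for i
    unfolding a_def using c \<delta> by (auto simp: add_pos_nonneg)
  \<comment> \<open>The grid extends so far that the cubes below its last threshold contribute at most
    \<open>2 powr (- n)\<close> in total.\<close>
  obtain k :: nat where "real k > (real CARD('d) + 1) / q / \<delta>" using reals_Archimedean2 by blast
  then have k: "a k * q \<ge> real CARD('d) + 1"
    unfolding a_def using \<delta> q0 c by (simp add: field_simps) (smt (verit) mult_pos_pos)
  define s where "s n = (\<Sum>Q\<in>S \<inter> D n. J Q powr q)" for n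
  \<comment> \<open>All \<open>k + 2\<close> contributions will be at most \<open>2 powr (- 2 * \<epsilon> * n)\<close>; half of this
    rate absorbs the factor \<open>k + 2\<close>.\<close>
  define \<epsilon> where "\<epsilon> = min 1 \<eta> / 2"
  have \<epsilon>: "\<epsilon> > 0" unfolding \<epsilon>_def using \<eta> by simp
  have evN: "\<forall>\<^sub>F n in sequentially. \<forall>i\<in>{..k}. real (N_alpha D S J (a i) n) \<le> 2 powr (a i * r * real n)"
    using eventually_N_alpha_le[OF r(1) a_pos] by (intro eventually_ball_finite) auto
  have evk: "\<forall>\<^sub>F n in sequentially. real k + 2 \<le> 2 powr (\<epsilon> * real n)"
  proof -
    have "filterlim (\<lambda>n. 2 powr (\<epsilon> * real n)) at_top sequentially" using \<epsilon> by real_asymp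
    then show ?thesis unfolding filterlim_at_top by blast
  qed
  have "\<forall>\<^sub>F n in sequentially. ereal (tau_n D S J n q) \<le> ereal (- \<epsilon>)"
    using evJ evN evk eventually_positive eventually_gt_at_top[of 0]
  proof eventually_elim
    case (elim n)
    let ?P = "\<lambda>i Q. J Q \<ge> 2 powr (- a i * real n)"
    let ?w = "\<lambda>i. 2 powr (- (a i - \<delta>) * real n * q)"
    let ?t = "2 powr (- (real CARD('d) + 1) * real n)"
    have pt: "J Q powr q \<le> ?t + (\<Sum>i\<le>k. if ?P i Q then ?w i else 0)" if Q: "Q \<in> S \<inter> D n" for Q
    proof (cases "?P k Q")
      case False
      then have "J Q powr q \<le> (2 powr (- a k * real n)) powr q"
        using J_nonneg Q q0 by (intro powr_mono2) auto
      also have "\<dots> = 2 powr (- (a k * q * real n))" by (simp add: powr_powr mult.commute mult.left_commute)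
      also have "\<dots> \<le> ?t" using mult_right_mono[OF k, of "real n"] by (simp add: algebra_simps)
      also have "\<dots> \<le> ?t + (\<Sum>i\<le>k. if ?P i Q then ?w i else 0)" by (simp add: sum_nonneg)
      finally show ?thesis .
    next
      case True
      \<comment> \<open>The least threshold reached by \<open>Q\<close> locates \<open>J Q\<close> between two neighbours;
        for \<open>i = 0\<close> the upper bound comes from the decay at rate \<open>c\<close>.\<close>
      define i where "i = (LEAST i. ?P i Q)"
      have i: "?P i Q" "i \<le> k" unfolding i_def using True by (auto intro: LeastI Least_le)
      have "J Q \<le> 2 powr (- (a i - \<delta>) * real n)"
      proof (cases i)
        case 0
        have "J Q \<le> 2 powr (- c * real n)" using elim(1) Q by blast
        also have "\<dots> \<le> 2 powr (- (a i - \<delta>) * real n)"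
          unfolding 0 a_def using \<delta> by (intro powr_mono mult_right_mono) auto
        finally show ?thesis .
      next
        case (Suc j)
        then have "\<not> ?P j Q" using not_less_Least[of j "\<lambda>i. ?P i Q"] unfolding i_def by simp
        moreover have "a i - \<delta> = a j" unfolding a_def Suc by (simp add: algebra_simps)
        ultimately show ?thesis by simp
      qed
      then have "J Q powr q \<le> (2 powr (- (a i - \<delta>) * real n)) powr q"
        using J_nonneg Q q0 by (intro powr_mono2) auto
      also have "\<dots> = (if ?P i Q then ?w i else 0)" using i by (simp add: powr_powr)
      also have "\<dots> \<le> (\<Sum>i\<le>k. if ?P i Q then ?w i else 0)"
        using i(2) by (intro member_le_sum) auto
      also have "\<dots> \<le> ?t + \<dots>" by simp
      finally show ?thesis .
    qed
    have "s n \<le> (\<Sum>Q\<in>S \<inter> D n. ?t + (\<Sum>i\<le>k. if ?P i Q then ?w i else 0))"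
      unfolding s_def by (rule sum_mono) (rule pt)
    also have "\<dots> = real (card (S \<inter> D n)) * ?t + (\<Sum>i\<le>k. \<Sum>Q\<in>S \<inter> D n. if ?P i Q then ?w i else 0)"
      by (simp add: sum.distrib sum.swap[of _ "{..k}"])
    also have "\<dots> = real (card (S \<inter> D n)) * ?t + (\<Sum>i\<le>k. real (N_alpha D S J (a i) n) * ?w i)"
      by (simp add: N_alpha_def sum.inter_filter[symmetric] finite_level)
    also have "\<dots> \<le> 2 powr (- \<epsilon> * 2 * real n) + (\<Sum>i\<le>k. 2 powr (- \<epsilon> * 2 * real n))"
    proof (intro add_mono sum_mono)
      have "card (S \<inter> D n) \<le> 2 ^ (CARD('d) * n)"
        using level_finite_card[of n] card_mono[of "D n" "S \<inter> D n"] by simp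
      then have "real (card (S \<inter> D n)) \<le> 2 powr (real CARD('d) * real n)"
        by (metis of_nat_le_iff of_nat_mult of_nat_numeral of_nat_power powr_realpow zero_less_numeral)
      then have "real (card (S \<inter> D n)) * ?t \<le> 2 powr (real CARD('d) * real n) * ?t"
        by (rule mult_right_mono) simp
      also have "\<dots> = 2 powr (- 1 * real n)" by (simp add: powr_add[symmetric] algebra_simps)
      also have "\<dots> \<le> 2 powr (- \<epsilon> * 2 * real n)"
        unfolding \<epsilon>_def by (intro powr_mono mult_right_mono) auto
      finally show "real (card (S \<inter> D n)) * ?t \<le> 2 powr (- \<epsilon> * 2 * real n)" .
    next
      fix i assume "i \<in> {..k}"
      then have "real (N_alpha D S J (a i) n) * ?w i \<le> 2 powr (a i * r * real n) * ?w i"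
        using elim(2) by (intro mult_right_mono) auto
      also have "\<dots> = 2 powr ((- ((q - r) * a i) + \<delta> * q) * real n)"
        by (simp add: powr_add[symmetric] algebra_simps)
      also have "\<dots> \<le> 2 powr (- \<epsilon> * 2 * real n)"
      proof (intro powr_mono mult_right_mono)
        have "(q - r) * a i \<ge> (q - r) * c" using a_ge rq by (intro mult_left_mono) auto
        moreover have "\<delta> * q = \<eta>" unfolding \<delta>_def using q0 by simp
        moreover have "(q - r) * c = 2 * \<eta>" unfolding \<eta>_def by simp
        moreover have "\<epsilon> * 2 \<le> \<eta>" unfolding \<epsilon>_def by simp
        ultimately show "- ((q - r) * a i) + \<delta> * q \<le> - \<epsilon> * 2" by linarith
      qed auto
      finally show "real (N_alpha D S J (a i) n) * ?w i \<le> 2 powr (- \<epsilon> * 2 * real n)" .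
    qed
    also have "\<dots> = (real k + 2) * 2 powr (- \<epsilon> * 2 * real n)" by (simp add: algebra_simps)
    also have "\<dots> \<le> 2 powr (\<epsilon> * real n) * 2 powr (- \<epsilon> * 2 * real n)"
      using elim(3) by (rule mult_right_mono) simp
    also have "\<dots> = 2 powr (- \<epsilon> * real n)" by (simp add: powr_add[symmetric] algebra_simps)
    finally have le: "s n \<le> 2 powr (- \<epsilon> * real n)" .
    \<comment> \<open>The partition sum must be positive, since \<open>ln 0 = 0\<close> would give \<open>tau_n\<close> the value 0.\<close>
    obtain Q where Q: "Q \<in> S \<inter> D n" "J Q > 0" using elim(4) by blast
    have "0 < J Q powr q" using Q by simp
    also have "\<dots> \<le> s n" unfolding s_def using Q finite_level by (intro member_le_sum) auto
    finally have "s n > 0" .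
    then have "ln (s n) \<le> ln (2 powr (- \<epsilon> * real n))" using le by (subst ln_le_cancel_iff) auto
    then show ?case using elim(5) unfolding tau_n_def s_def[symmetric]
      by (simp add: ln_powr ln_realpow field_simps)
  qed
  then have "tau D S J q \<le> ereal (- \<epsilon>)" unfolding tau_def by (rule Limsup_bounded)
  also have "\<dots> < 0" using \<epsilon> by simp
  finally show ?thesis .
qed

lemma q_exponent_le_F_upper:
  assumes "dim_infty D S J > 0"
  shows "q_exponent D S J \<le> F_upper D S J"
proof (rule dense_ge)
  fix y assume y: "F_upper D S J < y"
  show "q_exponent D S J \<le> y"
  proof (cases y)
    case (real q)
    then have "q \<ge> 0" using y F_upper_nonneg by (metis ereal_less_eq(5) less_imp_le order_trans)
    then show ?thesis
      unfolding real q_exponent_def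
      using tau_neg_if_F_upper_less[OF assms] y real by (intro INF_lower) auto
  qed (use y in auto)
qed

end

section \<open>The chain of exponents\<close>

theorem theorem1p4:
  fixes Q0 :: "(real ^ 'd) set"
    and D :: "nat \<Rightarrow> (real ^ 'd) set set"
    and S :: "(real ^ 'd) set set"
    and J :: "(real ^ 'd) set \<Rightarrow> real"
  assumes "dyadic_partitions Q0 D"
    and "S \<subseteq> (\<Union>n. D n)"
    and "\<forall>Q\<in>S. J Q \<ge> 0"
    and "nontrivial_on S J"
    and "monotone_set_function S J"
    and "uniformly_vanishing D S J"
    and "locally_nonvanishing D S J"
    and "tau_bounded_below D S J"
    and "dim_infty D S J > 0"
  shows "F_lower D S J \<le> h_lower D S J \<and>
         h_lower D S J \<le> h_upper D S J \<and>
         h_upper D S J = q_exponent D S J \<and>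
         q_exponent D S J = kappa_exponent S J \<and>
         kappa_exponent S J = F_upper D S J"
proof -
  interpret vanishing_set_function Q0 D S J
    using assms by unfold_locales auto
  have "h_lower D S J \<le> h_upper D S J"
    unfolding h_lower_def h_upper_def by (rule Liminf_le_Limsup) simp
  moreover note F_lower_le_h_lower F_upper_le_h_upper h_upper_le_kappa kappa_le_q_exponent
    q_exponent_le_F_upper[OF assms(9)]
  ultimately show ?thesis by (auto intro: antisym order_trans)
qed

end
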